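(* There exist a function $f:\mathbb{N}\to\mathbb{N}$ with exponential growth such that for each $n\in\mathbb{N}$, each $n$-folding curve contains a covering of a square $[x,x+f(n)]\times[y,y+f(n)]$ for some $x,y\in\mathbb{Z}$, i.e. every edge $[(u,v),(u+1,v)]$ or $[(u,v),(u,v+1)]$ with $u,v\in\mathbb{Z}$ contained in this square is the support of a segment of the curve.
   Context: All sequences take values in $\{+1,-1\}$. For $S=(a_1,\dots,a_n)$ write $\overline{S}=(-a_n,\dots,-a_1)$. The $n$-folding sequences are defined recursively: the only $0$-folding sequence is the empty sequence, and the $(n+1)$-folding sequences are exactly $(\overline{S},+1,S)$ and $(\overline{S},-1,S)$ with $S$ an $n$-folding sequence (so they have length $2^n-1$). A segment is an oriented unit edge of $\mathbb{Z}^2$ (ordered pair $(X,Y)$ of lattice points at distance $1$, with support the edge $[X,Y]$). A finite curve is a sequence $(C_1,\dots,C_m)$ of segments such that the terminal point of $C_i$ is the initial point of $C_{i+1}$, consecutive supports are perpendicular, and all supports are pairwise distinct; its associated sequence is $(\eta_1,\dots,\eta_{m-1})$ with $\eta_i=+1$ (resp. $-1$) if one turns left (resp. right) from $C_i$ to $C_{i+1}$. An $n$-folding curve is a finite curve with $2^n$ segments whose associated sequence is an $n$-folding sequence. "Exponential growth" means there are constants $c>0$ and $\lambda>1$ with $f(n)\ge c\lambda^n$ for all $n$.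
   Formalization: The bound f(n) ≥ cλ^n is required only for all sufficiently large n, not for all n: at n = 0 it would force f(0) ≥ 1, but a 0-folding curve is a single segment and cannot cover a unit square. The covering claim is still for every n. *)

theory Defs
  imports "HOL-Analysis.Analysis"
begin

definition seq_bar :: "int list \<Rightarrow> int list" where
  "seq_bar S = rev (map uminus S)"

inductive folding_seq :: "nat \<Rightarrow> int list \<Rightarrow> bool" where
  folding_seq_0: "folding_seq 0 []"
| folding_seq_plus: "folding_seq n S \<Longrightarrow> folding_seq (Suc n) (seq_bar S @ [1] @ S)"
| folding_seq_minus: "folding_seq n S \<Longrightarrow> folding_seq (Suc n) (seq_bar S @ [-1] @ S)"

type_synonym lattice_point = "int \<times> int"

type_synonym segment = "lattice_point \<times> lattice_point"

definition pt :: "lattice_point \<Rightarrow> real \<times> real" where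
  "pt X = (real_of_int (fst X), real_of_int (snd X))"

definition is_segment :: "segment \<Rightarrow> bool" where
  "is_segment s \<longleftrightarrow> dist (pt (fst s)) (pt (snd s)) = 1"

definition support :: "segment \<Rightarrow> (real \<times> real) set" where
  "support s = closed_segment (pt (fst s)) (pt (snd s))"

definition direction :: "segment \<Rightarrow> real \<times> real" where
  "direction s = pt (snd s) - pt (fst s)"

text \<open>The sign of the determinant of the two directions decides between a left turn
  (positive) and a right turn (negative); it is nonzero for perpendicular segments.\<close>

definition turn :: "segment \<Rightarrow> segment \<Rightarrow> int" where
  "turn s t =
     (if fst (direction s) * snd (direction t) - snd (direction s) * fst (direction t) > 0
      then 1 else -1)"

definition finite_curve :: "segment list \<Rightarrow> bool" where
  "finite_curve C \<longleftrightarrow>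
     (\<forall>s \<in> set C. is_segment s) \<and>
     (\<forall>i. Suc i < length C \<longrightarrow>
        snd (C ! i) = fst (C ! Suc i) \<and>
        orthogonal (direction (C ! i)) (direction (C ! Suc i))) \<and>
     distinct (map support C)"

definition assoc_seq :: "segment list \<Rightarrow> int list" where
  "assoc_seq C = map (\<lambda>i. turn (C ! i) (C ! Suc i)) [0..<length C - 1]"

definition folding_curve :: "nat \<Rightarrow> segment list \<Rightarrow> bool" where
  "folding_curve n C \<longleftrightarrow>
     finite_curve C \<and> length C = 2 ^ n \<and> folding_seq n (assoc_seq C)"

definition square :: "int \<Rightarrow> int \<Rightarrow> nat \<Rightarrow> (real \<times> real) set" where
  "square x y k =
     {real_of_int x .. real_of_int x + real k} \<times> {real_of_int y .. real_of_int y + real k}"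

definition covers_square :: "segment list \<Rightarrow> int \<Rightarrow> int \<Rightarrow> nat \<Rightarrow> bool" where
  "covers_square C x y k \<longleftrightarrow>
     (\<forall>u v :: int.
        \<forall>e \<in> {closed_segment (pt (u, v)) (pt (u + 1, v)),
             closed_segment (pt (u, v)) (pt (u, v + 1))}.
          e \<subseteq> square x y k \<longrightarrow> (\<exists>s \<in> set C. support s = e))"

text \<open>The bound is required for all sufficiently large arguments only: it forces
  \<open>f n \<ge> 1\<close> wherever it holds, while a curve with a single segment contains no
  covering of a square of positive side length.\<close>

definition exponential_growth :: "(nat \<Rightarrow> nat) \<Rightarrow> bool" where
  "exponential_growth f \<longleftrightarrow>
     (\<exists>c > 0. \<exists>l > 1. \<forall>\<^sub>F n in sequentially. real (f n) \<ge> c * l ^ n)"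

end

theory Submission
  imports Defs
begin

text \<open>The even-indexed vertices of an \<open>(n + 1)\<close>-folding curve form, after division by \<open>1 + \<i>\<close>,
  an \<open>n\<close>-folding curve, and the finer curve replaces each coarse edge by two sides of the unit
  cell on a side of that edge determined by parity alone. Hence a coarse unit cell with all four
  edges covered yields two diagonally adjacent fine ones. Describing the covered cells of one
  colour by a set \<open>B\<close> of Gaussian integers, one folding replaces \<open>B\<close> by \<open>(1 + \<i>) B + {0, u}\<close> with
  \<open>u \<in> {1, \<i>}\<close>. Every \<open>4\<close>-folding curve makes three equal consecutive turns and so encloses a cell;
  four foldings of any kind turn a single cell into a set containing a \<open>2 \<times> 2\<close> block, and two further
  foldings turn a \<open>(k + 1) \<times> (k + 1)\<close> block into a set containing a \<open>(2 k + 1) \<times> (2 k + 1)\<close> block.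
  Since every edge lies on a cell of the chosen colour, large blocks give large covered squares.\<close>

section \<open>Folding sequences as paperfolding sequences with free signs\<close>

text \<open>For \<open>k = 2\<^sup>m j\<close> with \<open>j\<close> odd, the value is \<open>e m\<close> or \<open>- e m\<close> according to \<open>j\<close> modulo 4;
  the value at 0 is irrelevant.\<close>

fun paperfold :: "(nat \<Rightarrow> int) \<Rightarrow> nat \<Rightarrow> int" where
  "paperfold e k =
     (if k = 0 then 1
      else if odd k then e 0 * (if k mod 4 = 1 then 1 else - 1)
      else paperfold (\<lambda>i. e (Suc i)) (k div 2))"

declare paperfold.simps [simp del]

lemma paperfold_odd: "odd k \<Longrightarrow> paperfold e k = e 0 * (if k mod 4 = 1 then 1 else - 1)"
  by (subst paperfold.simps) (auto elim: oddE)

lemma paperfold_double: "0 < k \<Longrightarrow> paperfold e (2 * k) = paperfold (\<lambda>i. e (Suc i)) k"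
  by (subst paperfold.simps) auto

lemma paperfold_power2: "paperfold e (2 ^ n) = e n"
  by (induction n arbitrary: e) (auto simp: paperfold_odd paperfold_double)

lemma odd_mod_4_iff: "odd k \<longleftrightarrow> k mod 4 = 1 \<or> k mod 4 = (3::nat)"
  by presburger

text \<open>\<open>k\<close> and \<open>2^n - k\<close> share their 2-adic valuation, and their odd
  parts add up to a power of two. If that power is a multiple of 4, the odd parts are opposite
  modulo 4; otherwise both are 1 and the changed sign at index \<open>n - 1\<close> does the
  work.\<close>

lemma paperfold_reflect:
  assumes "0 < k" "k < 2 ^ n"
    and "\<And>i. Suc i < n \<Longrightarrow> e' i = e i" and "\<And>i. Suc i = n \<Longrightarrow> e' i = - e i"
  shows "paperfold e' k = - paperfold e (2 ^ n - k)"
  using assms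
proof (induction n arbitrary: k e e')
  case (Suc n)
  show ?case
  proof (cases "even k")
    case True
    then obtain j where j: "k = 2 * j" by blast
    have "paperfold (\<lambda>i. e' (Suc i)) j = - paperfold (\<lambda>i. e (Suc i)) (2 ^ n - j)"
      using Suc.prems j by (intro Suc.IH) auto
    moreover have "2 ^ Suc n - k = 2 * (2 ^ n - j)" using j by simp
    ultimately show ?thesis
      using Suc.prems(1,2) j paperfold_double[of j e'] paperfold_double[of "2 ^ n - j" e] by simp
  next
    case False
    show ?thesis
    proof (cases n)
      case 0
      then show ?thesis using Suc.prems False by (simp add: paperfold_odd less_Suc_eq numeral_2_eq_2)
    next
      case (Suc m)
      then obtain q :: nat where q: "2 ^ Suc n = 4 * q" by simp
      define j where "j = 4 * q - k"
      have "k < 4 * q" using Suc.prems q by metis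
      then have kj: "k + j = 4 * q" by (simp add: j_def)
      then have "odd j" using False by presburger
      moreover have "j mod 4 = 1 \<longleftrightarrow> k mod 4 \<noteq> 1"
        using mod_add_eq[of k 4 j] kj False \<open>odd j\<close> by (auto simp: odd_mod_4_iff dest: dvd_imp_le)
      moreover have "e' 0 = e 0" using Suc.prems(3)[of 0] Suc by simp
      ultimately show ?thesis unfolding q j_def[symmetric] using False by (simp add: paperfold_odd)
    qed
  qed
qed simp

text \<open>Adding \<open>2^n\<close> preserves the valuation of \<open>k\<close> and its odd part
  modulo 4, except at \<open>k = 2^(n - 1)\<close>, where the odd part goes from 1 to 3 and the
  changed sign compensates.\<close>

lemma paperfold_shift:
  assumes "0 < k" "k < 2 ^ n"
    and "\<And>i. Suc i < n \<Longrightarrow> e' i = e i" and "\<And>i. Suc i = n \<Longrightarrow> e' i = - e i"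
  shows "paperfold e' (2 ^ n + k) = paperfold e k"
  using assms
proof (induction n arbitrary: k e e')
  case (Suc n)
  show ?case
  proof (cases "even k")
    case True
    then obtain j where j: "k = 2 * j" by blast
    have "paperfold (\<lambda>i. e' (Suc i)) (2 ^ n + j) = paperfold (\<lambda>i. e (Suc i)) j"
      using Suc.prems j by (intro Suc.IH) auto
    moreover have "2 ^ Suc n + k = 2 * (2 ^ n + j)" using j by simp
    ultimately show ?thesis
      using Suc.prems(1) j paperfold_double[of j e] paperfold_double[of "2 ^ n + j" e'] by simp
  next
    case False
    show ?thesis
    proof (cases n)
      case 0
      then have "k = 1" using Suc.prems by simp
      then show ?thesis using 0 Suc.prems by (simp add: paperfold_odd)
    next
      case (Suc m)
      then obtain q :: nat where q: "2 ^ Suc n = 4 * q" by simp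
      have "odd (4 * q + k)" "(4 * q + k) mod 4 = 1 \<longleftrightarrow> k mod 4 = 1"
        using False by presburger+
      moreover have "e' 0 = e 0" using Suc.prems(3)[of 0] Suc by simp
      ultimately show ?thesis unfolding q using False by (simp add: paperfold_odd)
    qed
  qed
qed simp

lemma paperfold_bar_append:
  assumes S: "length S + 1 = 2 ^ n" "\<And>k. k < length S \<Longrightarrow> S ! k = paperfold e (Suc k)"
    and e: "\<And>i. e i \<in> {1, - 1}" and g: "g \<in> {1, - 1}"
  shows "\<exists>e'. (\<forall>i. e' i \<in> {1, - 1}) \<and>
    (\<forall>k < length (seq_bar S @ [g] @ S). (seq_bar S @ [g] @ S) ! k = paperfold e' (Suc k))"
proof (intro exI conjI allI impI)
  \<comment> \<open>Position \<open>2^n\<close> reads index \<open>n\<close>, which gives the middle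
    entry; negating \<open>e (n - 1)\<close> serves the reflected left half and the shifted right
    half at once.\<close>
  let ?e' = "\<lambda>i. if i = n then g else if Suc i = n then - e i else e i"
  show "?e' i \<in> {1, - 1}" for i using e[of i] g by auto
  fix k assume k: "k < length (seq_bar S @ [g] @ S)"
  have len: "length (seq_bar S) = length S" by (simp add: seq_bar_def)
  consider "k < length S" | "k = length S" | j where "k = 2 ^ n + j" "j < length S"
  proof -
    assume a: "k < length S \<Longrightarrow> thesis" "k = length S \<Longrightarrow> thesis"
      "\<And>j. k = 2 ^ n + j \<Longrightarrow> j < length S \<Longrightarrow> thesis"
    show thesis using a(1,2) a(3)[of "k - 2 ^ n"] k len S(1) by fastforce
  qed
  then show "(seq_bar S @ [g] @ S) ! k = paperfold ?e' (Suc k)"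
  proof cases
    case 1
    have "(seq_bar S @ [g] @ S) ! k = - S ! (length S - Suc k)"
      using 1 len by (simp add: nth_append seq_bar_def rev_nth)
    also have "\<dots> = - paperfold e (2 ^ n - Suc k)"
      using 1 by (subst S(2)) (auto simp: Suc_diff_Suc simp flip: S(1))
    also have "\<dots> = paperfold ?e' (Suc k)"
      using 1 S(1) by (intro paperfold_reflect[symmetric]) auto
    finally show ?thesis .
  next
    case 2
    then have "Suc k = 2 ^ n" using S(1) by simp
    then show ?thesis using 2 len by (simp add: nth_append paperfold_power2)
  next
    case (3 j)
    have "(seq_bar S @ [g] @ S) ! k = paperfold e (Suc j)"
      using 3 len S(2) by (simp add: nth_append flip: S(1))
    also have "\<dots> = paperfold ?e' (2 ^ n + Suc j)"
      using 3 S(1) by (intro paperfold_shift[symmetric]) auto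
    finally show ?thesis using 3 by simp
  qed
qed

lemma folding_seq_paperfold:
  assumes "folding_seq n S"
  shows "length S + 1 = 2 ^ n \<and> (\<exists>e. (\<forall>i. e i \<in> {1, - 1}) \<and> (\<forall>k < length S. S ! k = paperfold e (Suc k)))"
  using assms
proof induction
  case folding_seq_0
  show ?case by (auto intro: exI[of _ "\<lambda>_. 1"])
next
  case (folding_seq_plus n S)
  then obtain e where "\<And>i. e i \<in> {1, - 1}" "\<And>k. k < length S \<Longrightarrow> S ! k = paperfold e (Suc k)"
    by metis
  with folding_seq_plus show ?case
    using paperfold_bar_append[of S n e 1] by (simp add: seq_bar_def)
next
  case (folding_seq_minus n S)
  then obtain e where "\<And>i. e i \<in> {1, - 1}" "\<And>k. k < length S \<Longrightarrow> S ! k = paperfold e (Suc k)"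
    by metis
  with folding_seq_minus show ?case
    using paperfold_bar_append[of S n e "- 1"] by (simp add: seq_bar_def)
qed

section \<open>Lattice paths with paperfolding turns\<close>

definition folding_path :: "nat \<Rightarrow> (nat \<Rightarrow> int) \<Rightarrow> (nat \<Rightarrow> lattice_point) \<Rightarrow> bool" where
  "folding_path n e P \<longleftrightarrow>
     (\<forall>i. e i \<in> {1, - 1}) \<and>
     (\<forall>k < 2 ^ n. P (Suc k) - P k \<in> {(1, 0), (0, 1), (- 1, 0), (0, - 1)}) \<and>
     (\<forall>k. Suc k < 2 ^ n \<longrightarrow>
        P (Suc (Suc k)) - P (Suc k) =
          (- paperfold e (Suc k) * snd (P (Suc k) - P k), paperfold e (Suc k) * fst (P (Suc k) - P k)))"

definition covered :: "(nat \<Rightarrow> lattice_point) \<Rightarrow> nat \<Rightarrow> lattice_point \<Rightarrow> lattice_point \<Rightarrow> bool" where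
  "covered P N p q \<longleftrightarrow> (\<exists>k < N. {P k, P (Suc k)} = {p, q})"

definition cell_covered :: "(nat \<Rightarrow> lattice_point) \<Rightarrow> nat \<Rightarrow> int \<Rightarrow> int \<Rightarrow> bool" where
  "cell_covered P N x y \<longleftrightarrow>
     covered P N (x, y) (x + 1, y) \<and> covered P N (x, y + 1) (x + 1, y + 1) \<and>
     covered P N (x, y) (x, y + 1) \<and> covered P N (x + 1, y) (x + 1, y + 1)"

lemma folding_pathD:
  assumes "folding_path n e P"
  shows "e i \<in> {1, - 1}"
    and "k < 2 ^ n \<Longrightarrow> P (Suc k) - P k \<in> {(1, 0), (0, 1), (- 1, 0), (0, - 1)}"
    and "Suc k < 2 ^ n \<Longrightarrow> P (Suc (Suc k)) - P (Suc k) =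
          (- paperfold e (Suc k) * snd (P (Suc k) - P k), paperfold e (Suc k) * fst (P (Suc k) - P k))"
  using assms unfolding folding_path_def by blast+

lemma paperfold_range:
  assumes "\<And>i. e i \<in> {1, - 1}" "0 < k"
  shows "paperfold e k \<in> {1, - 1}"
  using assms
proof (induction k arbitrary: e rule: less_induct)
  case (less k)
  show ?case
  proof (cases "even k")
    case True
    then obtain j where "k = 2 * j" by blast
    then show ?thesis using less.IH[of j "\<lambda>i. e (Suc i)"] less.prems by (auto simp: paperfold_double)
  next
    case False
    then show ?thesis using less.prems(1)[of 0] by (auto simp: paperfold_odd)
  qed
qed

lemma folding_path_prefix: "folding_path n e P \<Longrightarrow> m \<le> n \<Longrightarrow> folding_path m e P"
  unfolding folding_path_def
  by (meson one_le_numeral order_less_le_trans power_increasing)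

lemma covered_mono: "covered P M p q \<Longrightarrow> M \<le> N \<Longrightarrow> covered P N p q"
  unfolding covered_def by (meson order_less_le_trans)

lemma cell_covered_mono: "cell_covered P M x y \<Longrightarrow> M \<le> N \<Longrightarrow> cell_covered P N x y"
  unfolding cell_covered_def by (meson covered_mono)

text \<open>Each step flips the chessboard colour of the vertex, so the position determines the
  parity of the time.\<close>

lemma folding_path_parity:
  assumes "folding_path n e P" "k \<le> 2 ^ n"
  shows "even (fst (P k) + snd (P k) - fst (P 0) - snd (P 0)) \<longleftrightarrow> even k"
  using assms(2)
proof (induction k)
  case (Suc k)
  define a b where "a = fst (P k) + snd (P k)" and "b = fst (P (Suc k)) + snd (P (Suc k))"
  have "b = a + 1 \<or> b = a - 1"
    using folding_pathD(2)[OF assms(1), of k] Suc.prems by (auto simp: a_def b_def prod_eq_iff)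
  then show ?case using Suc.IH Suc.prems unfolding a_def[symmetric] b_def[symmetric] by auto
qed simp

lemma paperfold_Suc_double: "paperfold e (Suc (2 * k)) = e 0 * (if even k then 1 else - 1)"
proof -
  have "Suc (2 * k) mod 4 = 1 \<longleftrightarrow> even k" by presburger
  then show ?thesis by (simp add: paperfold_odd)
qed

lemma covered_sym: "covered P N p q \<longleftrightarrow> covered P N q p"
  unfolding covered_def by (simp add: insert_commute)

lemma covered_step: "k < N \<Longrightarrow> covered P N (P k) (P (Suc k))"
  unfolding covered_def by blast

section \<open>Unfolding a path once\<close>

text \<open>In Gaussian integers, \<open>derived P i\<close> is \<open>(P (2 * i) - P 0) / (1 + \<i>)\<close>, so that
  unfolding a folding path once gives a folding path in the rotated coarser lattice.\<close>

definition derived :: "(nat \<Rightarrow> lattice_point) \<Rightarrow> nat \<Rightarrow> lattice_point" where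
  "derived P i =
     ((fst (P (2 * i) - P 0) + snd (P (2 * i) - P 0)) div 2,
      (snd (P (2 * i) - P 0) - fst (P (2 * i) - P 0)) div 2)"

lemma double_derived:
  assumes "folding_path (Suc n) e P" "i \<le> 2 ^ n"
  shows "P (2 * i) = P 0 + (fst (derived P i) - snd (derived P i), fst (derived P i) + snd (derived P i))"
proof -
  define a b where "a = fst (P (2 * i)) - fst (P 0)" and "b = snd (P (2 * i)) - snd (P 0)"
  have "even (a + b)"
    using folding_path_parity[OF assms(1), of "2 * i"] assms(2) by (simp add: a_def b_def algebra_simps)
  then have "(a + b) div 2 - (b - a) div 2 = a" "(a + b) div 2 + (b - a) div 2 = b"
    by presburger+
  then show ?thesis by (simp add: derived_def prod_eq_iff a_def b_def)
qed

text \<open>Two fine steps add up to \<open>(1 + a * \<i>) * s\<close>. This is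
  \<open>(1 + \<i>) * t\<close> with \<open>t = s\<close> for a left turn and
  \<open>t = - \<i> * s\<close> for a right turn.\<close>

lemma derived_step:
  assumes P: "folding_path (Suc n) e P" and i: "i < 2 ^ n"
  defines "t \<equiv> derived P (Suc i) - derived P i"
  shows "t \<in> {(1, 0), (0, 1), (- 1, 0), (0, - 1)}"
    and "P (Suc (2 * i)) - P (2 * i) = (if paperfold e (Suc (2 * i)) = 1 then t else (- snd t, fst t))"
proof -
  define s where "s = P (Suc (2 * i)) - P (2 * i)"
  define a where "a = paperfold e (Suc (2 * i))"
  have a: "a = 1 \<or> a = - 1"
    using paperfold_range[of e "Suc (2 * i)"] folding_pathD(1)[OF P] by (simp add: a_def)
  have s: "s \<in> {(1, 0), (0, 1), (- 1, 0), (0, - 1)}"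
    unfolding s_def using i by (intro folding_pathD(2)[OF P]) simp
  have "P (Suc (Suc (2 * i))) - P (Suc (2 * i)) = (- a * snd s, a * fst s)"
    unfolding s_def a_def using i by (intro folding_pathD(3)[OF P]) simp
  then have "P (2 * Suc i) - P (2 * i) = s + (- a * snd s, a * fst s)"
    by (simp add: s_def prod_eq_iff)
  then have "fst t - snd t = fst s - a * snd s" "fst t + snd t = snd s + a * fst s"
    using double_derived[OF P, of i] double_derived[OF P, of "Suc i"] i
    by (auto simp: t_def prod_eq_iff)
  then have "t = (if a = 1 then s else (snd s, - fst s))"
    using a by (auto simp: prod_eq_iff)
  then show "t \<in> {(1, 0), (0, 1), (- 1, 0), (0, - 1)}"
    and "P (Suc (2 * i)) - P (2 * i) = (if paperfold e (Suc (2 * i)) = 1 then t else (- snd t, fst t))"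
    using s a unfolding a_def[symmetric] s_def[symmetric] by auto
qed

text \<open>Fine turns at odd positions alternate (\<open>alt\<close>). Hence the rotations between
  coarse steps and their first fine steps cancel against the fine turn at the odd position, and only
  the turn at position \<open>2 * Suc k\<close> remains.\<close>

lemma folding_path_derived:
  assumes P: "folding_path (Suc n) e P"
  shows "folding_path n (\<lambda>i. e (Suc i)) (derived P)"
  unfolding folding_path_def
proof (intro conjI allI impI)
  show "e (Suc i) \<in> {1, - 1}" for i using folding_pathD(1)[OF P] .
  show "derived P (Suc k) - derived P k \<in> {(1, 0), (0, 1), (- 1, 0), (0, - 1)}" if "k < 2 ^ n" for k
    using derived_step(1)[OF P that] .
  fix k assume k: "Suc k < 2 ^ n"
  define t t' where "t = derived P (Suc k) - derived P k"
    and "t' = derived P (Suc (Suc k)) - derived P (Suc k)"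
  define a where "a j = paperfold e (Suc j)" for j
  define s where "s j = P (Suc j) - P j" for j
  have a: "a j = 1 \<or> a j = - 1" for j
    using paperfold_range[of e "Suc j"] folding_pathD(1)[OF P] by (simp add: a_def)
  have turn: "s (Suc j) = (- a j * snd (s j), a j * fst (s j))" if "Suc j < 2 ^ Suc n" for j
    unfolding s_def a_def using folding_pathD(3)[OF P that] .
  have t: "s (2 * k) = (if a (2 * k) = 1 then t else (- snd t, fst t))"
    unfolding s_def a_def t_def using k by (intro derived_step(2)[OF P]) simp
  have t': "s (2 * Suc k) = (if a (2 * Suc k) = 1 then t' else (- snd t', fst t'))"
    unfolding s_def a_def t'_def using k by (intro derived_step(2)[OF P]) simp
  have alt: "a (2 * Suc k) = - a (2 * k)"
    unfolding a_def paperfold_Suc_double by simp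
  have "paperfold (\<lambda>i. e (Suc i)) (Suc k) = a (Suc (2 * k))"
    using paperfold_double[of "Suc k" e] by (simp add: a_def)
  moreover have "t' = (- a (Suc (2 * k)) * snd t, a (Suc (2 * k)) * fst t)"
    using t t' turn[of "2 * k"] turn[of "Suc (2 * k)"] alt a[of "2 * k"] k
    by (auto simp: prod_eq_iff)
  ultimately show "derived P (Suc (Suc k)) - derived P (Suc k) =
      (- paperfold (\<lambda>i. e (Suc i)) (Suc k) * snd (derived P (Suc k) - derived P k),
       paperfold (\<lambda>i. e (Suc i)) (Suc k) * fst (derived P (Suc k) - derived P k))"
    by (simp add: t_def t'_def)
qed

lemma derived_0: "derived P 0 = (0, 0)"
  by (simp add: derived_def)

text \<open>\<open>(u, v)\<close> is the first of the two fine steps replacing the coarse step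
  \<open>(a, b)\<close>. The derived path starts at the origin, so \<open>x + y\<close> has the
  parity of \<open>k\<close>, which fixes the turn between them.\<close>

lemma covered_derived_step:
  assumes P: "folding_path (Suc n) e P" and k: "k < 2 ^ n" and P0: "P 0 = (ox, oy)"
    and Q: "derived P k = (x, y)" "derived P (Suc k) = (x + a, y + b)"
    and uv: "(u, v) = (if even (x + y) \<longleftrightarrow> e 0 = 1 then (a, b) else (- b, a))"
  shows "covered P (2 ^ Suc n) (ox + x - y, oy + x + y) (ox + x - y + u, oy + x + y + v)"
    and "covered P (2 ^ Suc n) (ox + x - y + u, oy + x + y + v)
           (ox + x - y + a - b, oy + x + y + a + b)"
proof -
  have w: "P (2 * k) = (ox + x - y, oy + x + y)"
    using double_derived[OF P, of k] k by (simp add: P0 Q)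
  have w': "P (Suc (Suc (2 * k))) = (ox + x - y + a - b, oy + x + y + a + b)"
    using double_derived[OF P, of "Suc k"] k by (simp add: P0 Q)
  have "even (x + y) \<longleftrightarrow> even k"
    using folding_path_parity[OF folding_path_derived[OF P], of k] k by (simp add: derived_0 Q)
  then have "paperfold e (Suc (2 * k)) = 1 \<longleftrightarrow> (even (x + y) \<longleftrightarrow> e 0 = 1)"
    using folding_pathD(1)[OF P, of 0] by (auto simp: paperfold_Suc_double)
  then have "P (Suc (2 * k)) - P (2 * k) = (u, v)"
    using derived_step(2)[OF P k] uv by (simp add: Q)
  then have c: "P (Suc (2 * k)) = (ox + x - y + u, oy + x + y + v)"
    by (simp add: w prod_eq_iff)
  show "covered P (2 ^ Suc n) (ox + x - y, oy + x + y) (ox + x - y + u, oy + x + y + v)"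
    using covered_step[of "2 * k" "2 ^ Suc n" P] k by (simp add: w c)
  show "covered P (2 ^ Suc n) (ox + x - y + u, oy + x + y + v)
           (ox + x - y + a - b, oy + x + y + a + b)"
    using covered_step[of "Suc (2 * k)" "2 ^ Suc n" P] k by (simp add: w' c)
qed

text \<open>The side of a coarse edge on which the path bulges depends on the colour of its end point
  only: traversing the edge backwards changes the parity of both the time and the end point.\<close>

lemma covered_derived:
  assumes P: "folding_path (Suc n) e P" and P0: "P 0 = (ox, oy)"
    and cov: "covered (derived P) (2 ^ n) (x, y) (x + a, y + b)" and ab: "odd (a + b)"
    and uv: "(u, v) = (if even (x + y) \<longleftrightarrow> e 0 = 1 then (a, b) else (- b, a))"
  shows "covered P (2 ^ Suc n) (ox + x - y, oy + x + y) (ox + x - y + u, oy + x + y + v)"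
    and "covered P (2 ^ Suc n) (ox + x - y + u, oy + x + y + v)
           (ox + x - y + a - b, oy + x + y + a + b)"
proof -
  obtain k where k: "k < 2 ^ n"
    and "derived P k = (x, y) \<and> derived P (Suc k) = (x + a, y + b) \<or>
         derived P k = (x + a, y + b) \<and> derived P (Suc k) = (x, y)"
    using cov by (auto simp: covered_def doubleton_eq_iff)
  then consider (fwd) "derived P k = (x, y)" "derived P (Suc k) = (x + a, y + b)"
    | (bwd) "derived P k = (x + a, y + b)" "derived P (Suc k) = (x + a + - a, y + b + - b)" by auto
  then have "covered P (2 ^ Suc n) (ox + x - y, oy + x + y) (ox + x - y + u, oy + x + y + v) \<and>
    covered P (2 ^ Suc n) (ox + x - y + u, oy + x + y + v) (ox + x - y + a - b, oy + x + y + a + b)"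
  proof cases
    case fwd
    then show ?thesis using covered_derived_step[OF P k P0 fwd uv] by blast
  next
    case bwd
    have "even (x + a + (y + b)) \<longleftrightarrow> odd (x + y)" using ab by auto
    \<comment> \<open>Seen from the other end, the middle vertex is displaced by
      \<open>(u, v) - (1 + \<i>) * (a, b)\<close>.\<close>
    then have "(u - a + b, v - a - b) =
        (if even (x + a + (y + b)) \<longleftrightarrow> e 0 = 1 then (- a, - b) else (- (- b), - a))"
      using uv by (auto split: if_splits)
    from covered_derived_step[OF P k P0 bwd this]
    show ?thesis by (simp add: algebra_simps covered_sym)
  qed
  then show "covered P (2 ^ Suc n) (ox + x - y, oy + x + y) (ox + x - y + u, oy + x + y + v)"
    and "covered P (2 ^ Suc n) (ox + x - y + u, oy + x + y + v)
           (ox + x - y + a - b, oy + x + y + a + b)" by auto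
qed

text \<open>\<open>(cx, cy)\<close> is the centre of the enlarged coarse cell. Two opposite coarse
  edges bulge inward and meet there, the other two bulge outward. Each outward bulge closes up with
  one side of each inward bulge to a unit cell.\<close>

lemma cell_covered_derived:
  assumes P: "folding_path (Suc n) e P" and P0: "P 0 = (ox, oy)"
    and cov: "cell_covered (derived P) (2 ^ n) x y"
    and c: "cx = ox + x - y" "cy = oy + x + y + 1"
  shows "if even (x + y) \<longleftrightarrow> e 0 = 1
    then cell_covered P (2 ^ Suc n) (cx - 1) cy \<and> cell_covered P (2 ^ Suc n) cx (cy - 1)
    else cell_covered P (2 ^ Suc n) cx cy \<and> cell_covered P (2 ^ Suc n) (cx - 1) (cy - 1)"
proof -
  have *: "covered (derived P) (2 ^ n) (x, y) (x + 1, y + 0)"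
    "covered (derived P) (2 ^ n) (x, y + 1) (x + 1, y + 1 + 0)"
    "covered (derived P) (2 ^ n) (x, y) (x + 0, y + 1)"
    "covered (derived P) (2 ^ n) (x + 1, y) (x + 1 + 0, y + 1)"
    using cov by (simp_all add: cell_covered_def)
  note edges = *[THEN covered_derived(1)[OF P P0]] *[THEN covered_derived(2)[OF P P0]]
  show ?thesis
  proof (cases "even (x + y) \<longleftrightarrow> e 0 = 1")
    case True
    then have "even (x + (y + 1)) \<longleftrightarrow> e 0 \<noteq> 1" "even (x + 1 + y) \<longleftrightarrow> e 0 \<noteq> 1" by auto
    with True show ?thesis
      using edges(1)[of 1 0] edges(2)[of 0 1] edges(3)[of 0 1] edges(4)[of "- 1" 0]
        edges(5)[of 1 0] edges(6)[of 0 1] edges(7)[of 0 1] edges(8)[of "- 1" 0]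
      by (simp add: cell_covered_def c algebra_simps covered_sym)
  next
    case False
    then have "even (x + (y + 1)) \<longleftrightarrow> e 0 = 1" "even (x + 1 + y) \<longleftrightarrow> e 0 = 1" by auto
    with False show ?thesis
      using edges(1)[of 0 1] edges(2)[of 1 0] edges(3)[of "- 1" 0] edges(4)[of 0 1]
        edges(5)[of 0 1] edges(6)[of 1 0] edges(7)[of "- 1" 0] edges(8)[of 0 1]
      by (simp add: cell_covered_def c algebra_simps covered_sym)
  qed
qed

section \<open>Patterns of covered cells of one colour\<close>

text \<open>Cells of one colour have their lower left corners in a coset of \<open>(1 + \<i>) \<int>[\<i>]\<close>;
  \<open>B\<close> records them after division by \<open>1 + \<i>\<close>.\<close>

definition has_pattern :: "(nat \<Rightarrow> lattice_point) \<Rightarrow> nat \<Rightarrow> (int \<times> int) set \<Rightarrow> bool" where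
  "has_pattern P N B \<longleftrightarrow> (\<exists>x y. \<forall>p q. (p, q) \<in> B \<longrightarrow> cell_covered P N (x + p - q) (y + p + q))"

text \<open>This is \<open>(1 + \<i>) B + {0, u}\<close> with \<open>u = 1\<close> or \<open>u = \<i>\<close>.\<close>

definition fold_step :: "bool \<Rightarrow> (int \<times> int) set \<Rightarrow> (int \<times> int) set" where
  "fold_step h B = (\<lambda>(p, q). (p - q, p + q)) ` B \<union>
     (\<lambda>(p, q). if h then (p - q + 1, p + q) else (p - q, p + q + 1)) ` B"

lemma has_pattern_mono: "has_pattern P M B \<Longrightarrow> A \<subseteq> B \<Longrightarrow> M \<le> N \<Longrightarrow> has_pattern P N A"
  unfolding has_pattern_def by (meson cell_covered_mono subsetD)

text \<open>All cells of a pattern have the same colour, since \<open>(p - q) + (p + q)\<close> is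
  even. So they all split along the same diagonal and a single \<open>h\<close> serves them.\<close>

lemma has_pattern_fold_step:
  assumes P: "folding_path (Suc n) e P" and B: "has_pattern (derived P) (2 ^ n) B"
  shows "\<exists>h. has_pattern P (2 ^ Suc n) (fold_step h B)"
proof -
  obtain x y where B: "\<And>p q. (p, q) \<in> B \<Longrightarrow> cell_covered (derived P) (2 ^ n) (x + p - q) (y + p + q)"
    using B by (auto simp: has_pattern_def)
  obtain ox oy where P0: "P 0 = (ox, oy)" by fastforce
  define cx cy where "cx = ox + x - y" and "cy = oy + x + y + 1"
  have cells: "if even (x + y) \<longleftrightarrow> e 0 = 1
      then cell_covered P (2 ^ Suc n) (cx - 2 * q - 1) (cy + 2 * p) \<and>
        cell_covered P (2 ^ Suc n) (cx - 2 * q) (cy + 2 * p - 1)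
      else cell_covered P (2 ^ Suc n) (cx - 2 * q) (cy + 2 * p) \<and>
        cell_covered P (2 ^ Suc n) (cx - 2 * q - 1) (cy + 2 * p - 1)"
    if "(p, q) \<in> B" for p q
  proof -
    have "even (x + p - q + (y + p + q)) \<longleftrightarrow> even (x + y)" by simp
    with cell_covered_derived[OF P P0 B[OF that], of "cx - 2 * q" "cy + 2 * p"] show ?thesis
      by (simp add: cx_def cy_def)
  qed
  show ?thesis
  proof (cases "even (x + y) \<longleftrightarrow> e 0 = 1")
    case True
    \<comment> \<open>The two new cells differ by \<open>(- 1, 1)\<close>, which is
      \<open>(1 + \<i>) * \<i>\<close>, so \<open>u = \<i>\<close>.\<close>
    have "has_pattern P (2 ^ Suc n) (fold_step False B)"
      unfolding has_pattern_def
    proof (intro exI allI impI)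
      fix p' q' assume "(p', q') \<in> fold_step False B"
      then obtain p q where B: "(p, q) \<in> B"
        and *: "(cx + p' - q', cy - 1 + p' + q') \<in> {(cx - 2 * q, cy + 2 * p - 1), (cx - 2 * q - 1, cy + 2 * p)}"
        by (auto simp: fold_step_def)
      show "cell_covered P (2 ^ Suc n) (cx + p' - q') (cy - 1 + p' + q')"
        using cells[OF B, unfolded if_P[OF True]] * unfolding insert_iff empty_iff prod.inject
        by (elim disjE conjE) (simp_all only:)
    qed
    then show ?thesis ..
  next
    case False
    \<comment> \<open>Here the new cells differ by \<open>1 + \<i>\<close>, so
      \<open>u = 1\<close>.\<close>
    have "has_pattern P (2 ^ Suc n) (fold_step True B)"
      unfolding has_pattern_def
    proof (intro exI allI impI)
      fix p' q' assume "(p', q') \<in> fold_step True B"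
      then obtain p q where B: "(p, q) \<in> B"
        and *: "(cx - 1 + p' - q', cy - 1 + p' + q') \<in> {(cx - 2 * q - 1, cy + 2 * p - 1), (cx - 2 * q, cy + 2 * p)}"
        by (auto simp: fold_step_def)
      show "cell_covered P (2 ^ Suc n) (cx - 1 + p' - q') (cy - 1 + p' + q')"
        using cells[OF B, unfolded if_not_P[OF False]] * unfolding insert_iff empty_iff prod.inject
        by (elim disjE conjE) (simp_all only:)
    qed
    then show ?thesis ..
  qed
qed

section \<open>Existence of one enclosed cell\<close>

text \<open>If \<open>e 1 = - e 0\<close>, a run starts at position 2 or 4 according to whether
  \<open>e 2 = e 1\<close>; if \<open>e 1 = e 0\<close>, it starts at 8 or 6 according to whether
  the entry at 8 equals \<open>e 1\<close>. The bound 12 keeps the four adjacent edges among the 16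
  of a 4-folding path.\<close>

lemma paperfold_three_equal:
  assumes e: "\<And>i. e i \<in> {1, - 1}"
  obtains k where "k < 12" "paperfold e (Suc (Suc k)) = paperfold e (Suc k)" "paperfold e (Suc (Suc (Suc k))) = paperfold e (Suc k)"
proof -
  have odd: "paperfold e 3 = - e 0" "paperfold e 5 = e 0" "paperfold e 7 = - e 0" "paperfold e 9 = e 0" "paperfold e 11 = - e 0" "paperfold e 13 = e 0"
    by (simp_all add: paperfold_odd)
  have two: "paperfold e 2 = e 1" "paperfold e 6 = - e 1" "paperfold e 10 = e 1" "paperfold e 14 = - e 1"
    using paperfold_double[of 1 e] paperfold_double[of 3 e] paperfold_double[of 5 e] paperfold_double[of 7 e]
    by (simp_all add: paperfold_odd)
  have four: "paperfold e 4 = e 2" "paperfold e 12 = - e 2"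
    using paperfold_power2[of e 2] paperfold_double[of 6 e] paperfold_double[of 3 "\<lambda>i. e (Suc i)"]
      paperfold_odd[of 3 "\<lambda>i. e (Suc (Suc i))"]
    by (simp_all add: numeral_2_eq_2[symmetric])
  have "e 0 = 1 \<or> e 0 = - 1" "e 1 = 1 \<or> e 1 = - 1" "e 2 = 1 \<or> e 2 = - 1" "paperfold e 8 = 1 \<or> paperfold e 8 = - 1"
    using e[of 0] e[of 1] e[of 2] paperfold_range[OF e, of 8] by simp_all
  then have "\<exists>k \<in> {2, 4, 6, 8, 10, 12}. paperfold e (k + 1) = paperfold e k \<and> paperfold e (k + 2) = paperfold e k"
    by (elim disjE) (simp_all add: odd two four)
  then obtain k where k: "k \<in> {2, 4, 6, 8, 10, 12}" "paperfold e (k + 1) = paperfold e k \<and> paperfold e (k + 2) = paperfold e k" ..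
  have "0 < k" "k - 1 < 12" using k(1) by auto
  with k(2) show thesis using that[of "k - 1"] by simp
qed

text \<open>Three equal turns rotate successive steps by a quarter in one direction, so four steps
  run once around a unit cell.\<close>

lemma has_pattern_cell:
  assumes P: "folding_path 4 e P"
  shows "has_pattern P (2 ^ 4) {(0, 0)}"
proof -
  have e: "e i \<in> {1, - 1}" for i using folding_pathD(1)[OF P] .
  obtain k where k: "k < 12"
    and eq: "paperfold e (Suc (Suc k)) = paperfold e (Suc k)" "paperfold e (Suc (Suc (Suc k))) = paperfold e (Suc k)"
    by (rule paperfold_three_equal[OF e])
  define a where "a = paperfold e (Suc k)"
  have a: "a = 1 \<or> a = - 1" using paperfold_range[OF e, of "Suc k"] by (simp add: a_def)
  obtain x y where P0: "P k = (x, y)" by fastforce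
  obtain s t where st: "P (Suc k) - P k = (s, t)" by fastforce
  then have st_cases: "(s, t) \<in> {(1, 0), (0, 1), (- 1, 0), (0, - 1)}"
    using folding_pathD(2)[OF P, of k] k by auto
  have aa: "a * (a * z) = z" for z using a by auto
  have P1: "P (Suc k) = (x + s, y + t)" using st P0 by (simp add: prod_eq_iff)
  have P2: "P (Suc (Suc k)) = (x + s - a * t, y + t + a * s)"
    using folding_pathD(3)[OF P, of k] k P0 P1 by (simp add: prod_eq_iff a_def)
  have P3: "P (Suc (Suc (Suc k))) = (x - a * t, y + a * s)"
    using folding_pathD(3)[OF P, of "Suc k"] k P1 P2 eq aa by (simp add: prod_eq_iff flip: a_def)
  have P4: "P (Suc (Suc (Suc (Suc k)))) = (x, y)"
    using folding_pathD(3)[OF P, of "Suc (Suc k)"] k P2 P3 eq aa by (simp add: prod_eq_iff flip: a_def)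
  have cov: "covered P (2 ^ 4) (x, y) (x + s, y + t)"
    "covered P (2 ^ 4) (x + s, y + t) (x + s - a * t, y + t + a * s)"
    "covered P (2 ^ 4) (x + s - a * t, y + t + a * s) (x - a * t, y + a * s)"
    "covered P (2 ^ 4) (x - a * t, y + a * s) (x, y)"
    using covered_step[of k "2 ^ 4" P] covered_step[of "Suc k" "2 ^ 4" P]
      covered_step[of "Suc (Suc k)" "2 ^ 4" P] covered_step[of "Suc (Suc (Suc k))" "2 ^ 4" P]
      k P0 P1 P2 P3 P4 by simp_all
  \<comment> \<open>The vertices at times \<open>k\<close> and \<open>k + 2\<close> are opposite
    corners; the minima give the lower left one.\<close>
  have "cell_covered P (2 ^ 4) (min x (x + s - a * t)) (min y (y + t + a * s))"
    using st_cases a cov unfolding cell_covered_def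
    by (auto simp: covered_sym min_def simp del: power_numeral)
  then show ?thesis unfolding has_pattern_def by (intro exI) auto
qed

section \<open>Growth of blocks under folding\<close>

lemma fold_step_mem:
  "(p, q) \<in> B \<Longrightarrow> (p - q, p + q) \<in> fold_step h B"
  "(p, q) \<in> B \<Longrightarrow> (p - q + (if h then 1 else 0), p + q + (if h then 0 else 1)) \<in> fold_step h B"
  by (force simp: fold_step_def)+

text \<open>Each of the sixteen choices of \<open>h1\<close> to \<open>h4\<close> yields an explicit
  finite set, in which the block is found by inspection.\<close>

lemma fold_step_block_2:
  "\<exists>p q. {p..p + 1} \<times> {q..q + 1} \<subseteq>
     fold_step h4 (fold_step h3 (fold_step h2 (fold_step h1 {(0, 0)})))" (is "\<exists>p q. _ \<subseteq> ?B")
proof -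
  have "\<exists>r \<in> ?B. (fst r, snd r + 1) \<in> ?B \<and> (fst r + 1, snd r) \<in> ?B \<and> (fst r + 1, snd r + 1) \<in> ?B"
    by (cases h1; cases h2; cases h3; cases h4; simp add: fold_step_def)
  then obtain p q where "(p, q) \<in> ?B" "(p, q + 1) \<in> ?B" "(p + 1, q) \<in> ?B" "(p + 1, q + 1) \<in> ?B"
    by auto
  moreover have "{p..p + 1} \<times> {q..q + 1} = {(p, q), (p, q + 1), (p + 1, q), (p + 1, q + 1)}"
    by auto
  ultimately show ?thesis by (intro exI[of _ p] exI[of _ q]) simp
qed

text \<open>In the coordinates \<open>x + y\<close> and \<open>y - x\<close>, multiplication by
  \<open>1 + \<i>\<close> doubles the block and reaches the points with both coordinates even; the
  translate by \<open>u\<close> supplies those with both odd.\<close>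

lemma fold_step_rectangle:
  assumes B: "{a..a + m} \<times> {b..b + m} \<subseteq> B"
  shows "\<exists>t. \<forall>x y. 2 * a \<le> x + y \<and> x + y \<le> 2 * a + 2 * m + 1 \<and> t \<le> y - x \<and> y - x \<le> t + 2 * m + 1
           \<longrightarrow> (x, y) \<in> fold_step h B"
proof (intro exI allI impI)
  fix x y
  \<comment> \<open>The witness for \<open>t\<close> depends on \<open>h\<close>: adding 1 lowers
    \<open>y - x\<close> by one, adding \<i> raises it.\<close>
  assume xy: "2 * a \<le> x + y \<and> x + y \<le> 2 * a + 2 * m + 1 \<and>
    (if h then 2 * b - 1 else 2 * b) \<le> y - x \<and> y - x \<le> (if h then 2 * b - 1 else 2 * b) + 2 * m + 1"
  show "(x, y) \<in> fold_step h B"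
  proof (cases "even (x + y)")
    case True
    then obtain p where p: "x + y = 2 * p" by blast
    then have "(p, y - p) \<in> B" using xy by (intro subsetD[OF B]) (auto split: if_splits)
    from fold_step_mem(1)[OF this, of h] have "(2 * p - y, y) \<in> fold_step h B" by simp
    moreover have "x = 2 * p - y" using p by simp
    ultimately show ?thesis by simp
  next
    case False
    then obtain p where p: "x + y = 2 * p + 1" by (blast elim: oddE)
    define q where "q = (if h then y - p else y - 1 - p)"
    have "(p, q) \<in> B" using xy p by (intro subsetD[OF B]) (auto simp: q_def split: if_splits)
    moreover have "p - q + (if h then 1 else 0) = x" "p + q + (if h then 0 else 1) = y"
      using p by (auto simp: q_def)
    ultimately show ?thesis using fold_step_mem(2)[of p q B h] by simp
  qed
qed

text \<open>A second multiplication by \<open>1 + \<i>\<close> makes the tilted square upright, as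
  \<open>p + q\<close> and \<open>q - p\<close> become \<open>y\<close> and \<open>- x\<close>. The
  translate by \<open>u\<close> fills the points of odd coordinate sum, and a block of side
  \<open>2 * m\<close> lies in the ranges of both parities.\<close>

lemma fold_step_diamond:
  assumes B: "\<And>x y. s \<le> x + y \<Longrightarrow> x + y \<le> s + 2 * m + 1 \<Longrightarrow> t \<le> y - x \<Longrightarrow> y - x \<le> t + 2 * m + 1
    \<Longrightarrow> (x, y) \<in> B"
  shows "\<exists>p q. {p..p + 2 * m} \<times> {q..q + 2 * m} \<subseteq> fold_step h B"
proof (intro exI subrelI)
  fix x y
  assume "(x, y) \<in> {- t - 2 * m .. - t - 2 * m + 2 * m} \<times>
    {(if h then s else s + 1) .. (if h then s else s + 1) + 2 * m}"
  then have xy: "- t - 2 * m \<le> x" "x \<le> - t" "(if h then s else s + 1) \<le> y"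
    "y \<le> (if h then s else s + 1) + 2 * m" by auto
  show "(x, y) \<in> fold_step h B"
  proof (cases "even (x + y)")
    case True
    then obtain p where p: "x + y = 2 * p" by blast
    then have "(p, y - p) \<in> B" using xy by (intro B) (auto split: if_splits)
    from fold_step_mem(1)[OF this, of h] have "(2 * p - y, y) \<in> fold_step h B" by simp
    moreover have "x = 2 * p - y" using p by simp
    ultimately show ?thesis by simp
  next
    case False
    then obtain p where p: "x + y = 2 * p + 1" by (blast elim: oddE)
    define q where "q = (if h then y - p else y - 1 - p)"
    have "(p, q) \<in> B" using xy p by (intro B) (auto simp: q_def split: if_splits)
    moreover have "p - q + (if h then 1 else 0) = x" "p + q + (if h then 0 else 1) = y"
      using p by (auto simp: q_def)
    ultimately show ?thesis using fold_step_mem(2)[of p q B h] by simp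
  qed
qed

text \<open>The path derived four times still has four foldings, enough for one cell; restoring the
  other four makes it a block.\<close>

lemma has_pattern_block_2:
  assumes P: "folding_path 8 e P"
  shows "\<exists>p q. has_pattern P (2 ^ 8) ({p..p + 1} \<times> {q..q + 1})"
proof -
  have n: "Suc 4 = 5" "Suc 5 = 6" "Suc 6 = 7" "Suc 7 = (8::nat)" by simp_all
  note P7 = folding_path_derived[where n = 7, unfolded n, OF P]
  note P6 = folding_path_derived[where n = 6, unfolded n, OF P7]
  note P5 = folding_path_derived[where n = 5, unfolded n, OF P6]
  note P4 = folding_path_derived[where n = 4, unfolded n, OF P5]
  obtain h1 where "has_pattern (derived (derived (derived P))) (2 ^ 5) (fold_step h1 {(0, 0)})"
    using has_pattern_fold_step[where n = 4, unfolded n, OF P5 has_pattern_cell[OF P4]] by blast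
  then obtain h2 where "has_pattern (derived (derived P)) (2 ^ 6) (fold_step h2 (fold_step h1 {(0, 0)}))"
    using has_pattern_fold_step[where n = 5, unfolded n, OF P6] by blast
  then obtain h3 where
    "has_pattern (derived P) (2 ^ 7) (fold_step h3 (fold_step h2 (fold_step h1 {(0, 0)})))"
    using has_pattern_fold_step[where n = 6, unfolded n, OF P7] by blast
  then obtain h4 where
    "has_pattern P (2 ^ 8) (fold_step h4 (fold_step h3 (fold_step h2 (fold_step h1 {(0, 0)}))))"
    using has_pattern_fold_step[where n = 7, unfolded n, OF P] by blast
  then show ?thesis
    using fold_step_block_2[of h4 h3 h2 h1] has_pattern_mono by blast
qed

text \<open>Two foldings double the side: the first gives a tilted square without gaps, the second
  an upright one.\<close>

lemma has_pattern_block: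
  assumes "folding_path (8 + 2 * j) e P"
  shows "\<exists>p q. has_pattern P (2 ^ (8 + 2 * j)) ({p..p + 2 ^ j} \<times> {q..q + 2 ^ j})"
  using assms
proof (induction j arbitrary: e P)
  case 0
  then show ?case using has_pattern_block_2[of e P] by simp
next
  case (Suc j)
  define n where "n = 8 + 2 * j"
  have n: "8 + 2 * Suc j = Suc (Suc n)" by (simp add: n_def)
  note P = Suc.prems[unfolded n]
  note P' = folding_path_derived[OF P]
  note P'' = folding_path_derived[OF P']
  obtain p q where "has_pattern (derived (derived P)) (2 ^ n) ({p..p + 2 ^ j} \<times> {q..q + 2 ^ j})"
    using Suc.IH[folded n_def, OF P''] by blast
  then obtain h h' where pat: "has_pattern P (2 ^ Suc (Suc n))
      (fold_step h' (fold_step h ({p..p + 2 ^ j} \<times> {q..q + 2 ^ j})))"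
    using has_pattern_fold_step[OF P'] has_pattern_fold_step[OF P] by meson
  obtain t where "\<And>x y. 2 * p \<le> x + y \<Longrightarrow> x + y \<le> 2 * p + 2 * 2 ^ j + 1 \<Longrightarrow> t \<le> y - x \<Longrightarrow>
      y - x \<le> t + 2 * 2 ^ j + 1 \<Longrightarrow> (x, y) \<in> fold_step h ({p..p + 2 ^ j} \<times> {q..q + 2 ^ j})"
    using fold_step_rectangle[OF subset_refl, where a = p and b = q and m = "2 ^ j" and h = h] by blast
  from fold_step_diamond[OF this, where h = h']
  show ?case unfolding n using has_pattern_mono[OF pat] by (simp del: power_Suc add: power_Suc[of _ j]) blast
qed

section \<open>From blocks of cells to covered squares\<close>

text \<open>The block describes the cells of one colour in a tilted square, and each edge borders
  exactly one cell of that colour. An upright square of half side \<open>r\<close> about the centre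
  reaches \<open>2 * r\<close> in the coordinates \<open>u + v\<close> and \<open>v - u\<close>;
  strictness leaves room for a cell below or to the left of an edge.\<close>

lemma has_pattern_covers:
  assumes pat: "has_pattern P N ({p..p + m} \<times> {q..q + m})" and r: "2 * r < m"
  shows "\<exists>x y. \<forall>u v.
    (x \<le> u \<and> u + 1 \<le> x + 2 * r \<and> y \<le> v \<and> v \<le> y + 2 * r \<longrightarrow> covered P N (u, v) (u + 1, v)) \<and>
    (x \<le> u \<and> u \<le> x + 2 * r \<and> y \<le> v \<and> v + 1 \<le> y + 2 * r \<longrightarrow> covered P N (u, v) (u, v + 1))"
proof -
  obtain x y where cells: "\<And>a b. a \<in> {p..p + m} \<Longrightarrow> b \<in> {q..q + m} \<Longrightarrow> cell_covered P N (x + a - b) (y + a + b)"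
    using pat by (auto simp: has_pattern_def)
  \<comment> \<open>The centre of the tilted square.\<close>
  define cx cy where "cx = x + p - q" and "cy = y + p + q + m"
  have cell: "cell_covered P N u v" if even: "even (u - x + (v - y))"
    and near: "cx + cy - m \<le> u + v" "u + v \<le> cx + cy + m" "cy - cx - m \<le> v - u" "v - u \<le> cy - cx + m" for u v
  proof -
    obtain a where a: "u - x + (v - y) = 2 * a" using even by blast
    have "cell_covered P N (x + a - (v - y - a)) (y + a + (v - y - a))"
      using a near by (intro cells) (auto simp: cx_def cy_def)
    moreover have "x + a - (v - y - a) = u" using a by simp
    ultimately show ?thesis by simp
  qed
  show ?thesis
  proof (intro exI allI conjI impI)
    fix u v assume uv: "cx - r \<le> u \<and> u + 1 \<le> cx - r + 2 * r \<and> cy - r \<le> v \<and> v \<le> cy - r + 2 * r"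
    show "covered P N (u, v) (u + 1, v)"
    proof (cases "even (u - x + (v - y))")
      case True
      then have "cell_covered P N u v" using uv r by (intro cell) auto
      then show ?thesis by (simp add: cell_covered_def)
    next
      case False
      then have "cell_covered P N u (v - 1)" using uv r by (intro cell) auto
      then show ?thesis by (simp add: cell_covered_def)
    qed
  next
    fix u v assume uv: "cx - r \<le> u \<and> u \<le> cx - r + 2 * r \<and> cy - r \<le> v \<and> v + 1 \<le> cy - r + 2 * r"
    show "covered P N (u, v) (u, v + 1)"
    proof (cases "even (u - x + (v - y))")
      case True
      then have "cell_covered P N u v" using uv r by (intro cell) auto
      then show ?thesis by (simp add: cell_covered_def)
    next
      case False
      then have "cell_covered P N (u - 1) v" using uv r by (intro cell) auto
      then show ?thesis by (simp add: cell_covered_def)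
    qed
  qed
qed

section \<open>From folding curves to lattice paths\<close>

lemma is_segment_unit:
  assumes "is_segment s"
  shows "snd s - fst s \<in> {(1, 0), (0, 1), (- 1, 0), (0, - 1)}"
proof -
  obtain a b where ab: "snd s - fst s = (a, b)" by fastforce
  then have "pt (snd s) - pt (fst s) = (real_of_int a, real_of_int b)"
    by (auto simp: pt_def prod_eq_iff)
  then have "dist (pt (fst s)) (pt (snd s)) = sqrt ((real_of_int a)\<^sup>2 + (real_of_int b)\<^sup>2)"
    by (simp add: dist_norm norm_minus_commute[of "pt (fst s)"] norm_Pair)
  then have "(real_of_int a)\<^sup>2 + (real_of_int b)\<^sup>2 = 1"
    using assms by (simp add: is_segment_def)
  then have "real_of_int (a\<^sup>2 + b\<^sup>2) = real_of_int 1" by simp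
  then have eq: "a\<^sup>2 + b\<^sup>2 = 1" by (simp only: of_int_eq_iff)
  have "a\<^sup>2 \<le> 1\<^sup>2" "b\<^sup>2 \<le> 1\<^sup>2"
    using eq zero_le_power2[of a] zero_le_power2[of b] by (simp_all del: zero_le_power2, linarith+)
  then have "\<bar>a\<bar> \<le> 1" "\<bar>b\<bar> \<le> 1" by (simp_all only: abs_le_square_iff[symmetric] abs_one)
  then have "a \<in> {- 1, 0, 1}" "b \<in> {- 1, 0, 1}" by auto
  then show ?thesis using eq ab by auto
qed

text \<open>Orthogonality leaves \<i> or - \<i> times the previous step, and the determinant in
  \<open>turn\<close> picks the sign.\<close>

lemma turn_rotates:
  assumes "is_segment s" "is_segment t" "orthogonal (direction s) (direction t)"
  shows "snd t - fst t = (- turn s t * snd (snd s - fst s), turn s t * fst (snd s - fst s))"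
proof -
  obtain a b where ab: "snd s - fst s = (a, b)" by fastforce
  obtain c d where cd: "snd t - fst t = (c, d)" by fastforce
  have "direction s = (real_of_int a, real_of_int b)" "direction t = (real_of_int c, real_of_int d)"
    using ab cd by (auto simp: direction_def pt_def prod_eq_iff)
  then show ?thesis
    using is_segment_unit[OF assms(1)] is_segment_unit[OF assms(2)] assms(3)
    unfolding ab cd turn_def orthogonal_def by auto
qed

lemma folding_curve_path:
  assumes "folding_curve n C"
  obtains e P where "folding_path n e P" "\<And>k. k < 2 ^ n \<Longrightarrow> C ! k = (P k, P (Suc k))"
proof -
  have len: "length C = 2 ^ n" and seq: "folding_seq n (assoc_seq C)"
    and segs: "\<And>k. k < 2 ^ n \<Longrightarrow> is_segment (C ! k)"
    and join: "\<And>k. Suc k < 2 ^ n \<Longrightarrow> snd (C ! k) = fst (C ! Suc k)"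
    and orth: "\<And>k. Suc k < 2 ^ n \<Longrightarrow> orthogonal (direction (C ! k)) (direction (C ! Suc k))"
    using assms by (auto simp: folding_curve_def finite_curve_def)
  obtain e where e: "\<And>i. e i \<in> {1, - 1}"
    and paperfold: "\<And>k. k < length (assoc_seq C) \<Longrightarrow> assoc_seq C ! k = paperfold e (Suc k)"
    using folding_seq_paperfold[OF seq] by blast
  have turn: "turn (C ! k) (C ! Suc k) = paperfold e (Suc k)" if "Suc k < 2 ^ n" for k
    using paperfold[of k] that len by (simp add: assoc_seq_def)
  \<comment> \<open>The \<open>2^n\<close> segments have \<open>2^n + 1\<close> vertices; the last
    is a terminal point only.\<close>
  define P where "P k = (if k < 2 ^ n then fst (C ! k) else snd (C ! (2 ^ n - 1)))" for k
  have C: "C ! k = (P k, P (Suc k))" if "k < 2 ^ n" for k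
  proof (cases "Suc k < 2 ^ n")
    case True
    then show ?thesis using join[OF True] that by (simp add: P_def prod_eq_iff)
  next
    case False
    then have "k = 2 ^ n - 1" using that by simp
    then show ?thesis using that by (simp add: P_def prod_eq_iff)
  qed
  have "folding_path n e P"
    unfolding folding_path_def
  proof (intro conjI allI impI)
    show "e i \<in> {1, - 1}" for i by (rule e)
    show "P (Suc k) - P k \<in> {(1, 0), (0, 1), (- 1, 0), (0, - 1)}" if "k < 2 ^ n" for k
      using is_segment_unit[OF segs[OF that]] C[OF that] by simp
    show "P (Suc (Suc k)) - P (Suc k) =
        (- paperfold e (Suc k) * snd (P (Suc k) - P k), paperfold e (Suc k) * fst (P (Suc k) - P k))"
      if "Suc k < 2 ^ n" for k
      using turn_rotates[OF segs[of k] segs[of "Suc k"] orth[of k]] that turn[OF that] C[of k] C[of "Suc k"] by simp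
  qed
  then show thesis using C by (rule that)
qed

section \<open>Covered squares and their growth\<close>

lemma folding_curve_covers_square:
  assumes C: "folding_curve n C" and n: "12 + 2 * i \<le> n"
  shows "\<exists>x y. covers_square C x y (2 * 2 ^ i)"
proof -
  obtain e P where P: "folding_path n e P" and CP: "\<And>k. k < 2 ^ n \<Longrightarrow> C ! k = (P k, P (Suc k))"
    using folding_curve_path[OF C] by blast
  have len: "length C = 2 ^ n" using C by (simp add: folding_curve_def)
  \<comment> \<open>Index \<open>i + 2\<close> gives blocks of side \<open>4 * 2^i\<close>, so that
    \<open>2 * r < m\<close> holds strictly for \<open>r = 2^i\<close>.\<close>
  have "8 + 2 * (i + 2) \<le> n" using n by simp
  from has_pattern_block[OF folding_path_prefix[OF P this]]
  obtain p q where "has_pattern P (2 ^ n) ({p..p + 2 ^ (i + 2)} \<times> {q..q + 2 ^ (i + 2)})"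
    using has_pattern_mono[OF _ subset_refl power_increasing[OF \<open>8 + 2 * (i + 2) \<le> n\<close>]] by fastforce
  from has_pattern_covers[OF this, of "2 ^ i"]
  obtain x y where
    hor: "\<And>u v. x \<le> u \<Longrightarrow> u + 1 \<le> x + 2 * 2 ^ i \<Longrightarrow> y \<le> v \<Longrightarrow> v \<le> y + 2 * 2 ^ i
      \<Longrightarrow> covered P (2 ^ n) (u, v) (u + 1, v)" and
    ver: "\<And>u v. x \<le> u \<Longrightarrow> u \<le> x + 2 * 2 ^ i \<Longrightarrow> y \<le> v \<Longrightarrow> v + 1 \<le> y + 2 * 2 ^ i
      \<Longrightarrow> covered P (2 ^ n) (u, v) (u, v + 1)" by auto
  have supp: "\<exists>s \<in> set C. support s = closed_segment (pt a) (pt b)" if cov: "covered P (2 ^ n) a b" for a b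
  proof -
    obtain k where k: "k < 2 ^ n" "{P k, P (Suc k)} = {a, b}" using cov unfolding covered_def by blast
    then have "support (C ! k) = closed_segment (pt a) (pt b)"
      by (auto simp: CP support_def doubleton_eq_iff closed_segment_commute)
    then show ?thesis using k len by (metis nth_mem)
  qed
  have sq: "pt (u, v) \<in> square x y (2 * 2 ^ i) \<longleftrightarrow> x \<le> u \<and> u \<le> x + 2 * 2 ^ i \<and> y \<le> v \<and> v \<le> y + 2 * 2 ^ i"
    for u v
  proof -
    have "real_of_int z + real (2 * 2 ^ i) = real_of_int (z + 2 * 2 ^ i)" for z by simp
    then show ?thesis unfolding square_def pt_def by (simp only: mem_Times_iff fst_conv snd_conv
        atLeastAtMost_iff of_int_le_iff conj_assoc)
  qed
  have "covers_square C x y (2 * 2 ^ i)"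
    unfolding covers_square_def
  proof (intro allI ballI impI)
    fix u v :: int and E
    assume E: "E \<in> {closed_segment (pt (u, v)) (pt (u + 1, v)), closed_segment (pt (u, v)) (pt (u, v + 1))}"
      and sub: "E \<subseteq> square x y (2 * 2 ^ i)"
    from E consider "E = closed_segment (pt (u, v)) (pt (u + 1, v))"
      | "E = closed_segment (pt (u, v)) (pt (u, v + 1))" by blast
    then show "\<exists>s \<in> set C. support s = E"
    proof cases
      case 1
      then have "pt (u, v) \<in> square x y (2 * 2 ^ i)" "pt (u + 1, v) \<in> square x y (2 * 2 ^ i)"
        using sub by auto
      then show ?thesis unfolding 1 sq by (intro supp hor) auto
    next
      case 2
      then have "pt (u, v) \<in> square x y (2 * 2 ^ i)" "pt (u, v + 1) \<in> square x y (2 * 2 ^ i)"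
        using sub by auto
      then show ?thesis unfolding 2 sq by (intro supp ver) auto
    qed
  qed
  then show ?thesis by blast
qed

text \<open>A square of side 0 is a single point and contains no unit edge.\<close>

lemma covers_square_0: "covers_square C x y 0"
proof -
  have False if "closed_segment (pt (u, v)) (pt (u', v')) \<subseteq> square x y 0" "(u, v) \<noteq> (u', v')" for u v u' v'
  proof -
    have "pt (u, v) \<in> square x y 0" "pt (u', v') \<in> square x y 0" using that(1) by auto
    then show False using that(2) by (simp add: square_def pt_def)
  qed
  then show ?thesis by (fastforce simp: covers_square_def)
qed

theorem theorem3p1:
  "\<exists>f :: nat \<Rightarrow> nat. exponential_growth f \<and>
     (\<forall>n C. folding_curve n C \<longrightarrow> (\<exists>x y :: int. covers_square C x y (f n)))"
proof -
  define f :: "nat \<Rightarrow> nat" where "f n = (if n < 12 then 0 else 2 * 2 ^ ((n - 12) div 2))" for n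
  \<comment> \<open>Two foldings double the side, hence the rate \<open>sqrt 2\<close>. The constant
    comes from \<open>sqrt 2 * 2^(6 + i) \<le> 64 * (2 * 2^i)\<close>, where the factor
    \<open>sqrt 2\<close> absorbs the rounding in \<open>div 2\<close>.\<close>
  have "1 / 64 * sqrt 2 ^ n \<le> real (f n)" if "n \<ge> 12" for n
  proof -
    define i where "i = (n - 12) div 2"
    have "n \<le> Suc (2 * (6 + i))" using that by (simp add: i_def)
    then have "sqrt 2 ^ n \<le> sqrt 2 ^ Suc (2 * (6 + i))" by (intro power_increasing) auto
    also have "\<dots> = sqrt 2 * 2 ^ (6 + i)" by (simp only: power_Suc power_mult real_sqrt_pow2)
    also have "\<dots> \<le> 2 * 2 ^ (6 + i)"
      by (intro mult_right_mono real_le_lsqrt) auto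
    finally show ?thesis using that by (simp add: f_def i_def power_add)
  qed
  then have "exponential_growth f"
    unfolding exponential_growth_def
    by (intro exI[of _ "1 / 64"] exI[of _ "sqrt 2"] conjI eventually_sequentiallyI[of 12]) auto
  moreover have "\<exists>x y. covers_square C x y (f n)" if C: "folding_curve n C" for n C
  proof (cases "n < 12")
    case True
    then show ?thesis using covers_square_0 by (simp add: f_def)
  next
    case False
    then have "12 + 2 * ((n - 12) div 2) \<le> n" by simp
    with folding_curve_covers_square[OF C this] False show ?thesis by (simp add: f_def)
  qed
  ultimately show ?thesis by blast
qed

end
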